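(* Let $q=p^m$ with $p$ an odd prime and $m\in\mathbb{N}$, and let $k\in\mathbb{N}$ with $k\mid q-1$. The graph $\Gamma(k,q)$ is undirected if and only if $v_2(k)<v_2(q-1)$ or $v_2(k)=0$. Equivalently, $\Gamma(k,q)$ is directed if and only if $v_2(k)=v_2(q-1)>0$. In this case, $k$ is even, $\Gamma(\tfrac k2,q)$ is undirected, the arc set of $\Gamma(\tfrac k2,q)$ is the union of the arc set of $\Gamma(k,q)$ and the arc set of $\Gamma(k,q)$ with all arcs reversed (equivalently $R_{k/2}=R_k\cup(-R_k)$, a disjoint union), and $$Spec(\Gamma(\tfrac k2,q)) = \{2\,\mathrm{Re}(\lambda) : \lambda\in Spec(\Gamma(k,q))\}$$ as multisets.
   Context: For $k\in\mathbb{N}$ let $R_k=\{x^k : x\in\mathbb{F}_q^*\}$. The generalized Paley graph $\Gamma(k,q)$ has vertex set $\mathbb{F}_q$ and an arc $x\to y$ iff $y-x\in R_k$; it is undirected if $R_k=-R_k$ and directed otherwise. $Spec$ denotes the multiset of adjacency eigenvalues. $v_2(n)$ is the $2$-adic valuation of $n$ ($v_2(n)=t$ iff $n=2^t u$ with $u$ odd). *)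

theory Defs
  imports
    "HOL-Analysis.Analysis"
    "HOL-Computational_Algebra.Computational_Algebra"
    "Graph_Theory.Pair_Digraph"
begin

definition power_set :: "nat \<Rightarrow> 'a::field set" where
  "power_set k = (\<lambda>x. x ^ k) ` (UNIV - {0})"

definition gen_paley :: "nat \<Rightarrow> 'a::field pair_pre_digraph" where
  "gen_paley k = \<lparr>pverts = UNIV, parcs = {(x, y). y - x \<in> power_set k}\<rparr>"

text \<open>
  The field is the type argument, passed as \<open>TYPE('a)\<close>. The lemma \<open>gp_undirected_iff_symmetric\<close>
  relates this condition on connection sets to symmetry of the digraph.
\<close>

definition gp_undirected :: "'a::field itself \<Rightarrow> nat \<Rightarrow> bool" where
  "gp_undirected _ k \<longleftrightarrow> (power_set k :: 'a set) = uminus ` power_set k"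

abbreviation gp_directed :: "'a::field itself \<Rightarrow> nat \<Rightarrow> bool" where
  "gp_directed F k \<equiv> \<not> gp_undirected F k"

lemma gp_undirected_iff_symmetric:
  "gp_undirected TYPE('a::field) k \<longleftrightarrow> symmetric (with_proj (gen_paley k :: 'a pair_pre_digraph))"
proof
  assume u: "gp_undirected TYPE('a) k"
  have neg: "- d \<in> power_set k" if "d \<in> power_set k" for d :: 'a
    using u that unfolding gp_undirected_def by auto
  show "symmetric (with_proj (gen_paley k :: 'a pair_pre_digraph))"
    unfolding symmetric_def sym_def by (auto simp: gen_paley_def dest: neg)
next
  assume s: "symmetric (with_proj (gen_paley k :: 'a pair_pre_digraph))"
  have neg: "- d \<in> power_set k" if "d \<in> power_set k" for d :: 'a
  proof -
    have "(0, d) \<in> parcs (gen_paley k)" using that by (simp add: gen_paley_def)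
    then have "(d, 0) \<in> parcs (gen_paley k)"
      using s by (auto simp: symmetric_def sym_def)
    then show ?thesis by (simp add: gen_paley_def)
  qed
  have "d \<in> uminus ` power_set k" if "d \<in> power_set k" for d :: 'a
    using neg[OF that] by (intro image_eqI[of _ _ "- d"]) auto
  then show "gp_undirected TYPE('a) k"
    unfolding gp_undirected_def using neg by blast
qed

text \<open>
  Rows and columns are indexed by the whole vertex type, so this is the adjacency matrix of
  a digraph \<open>G\<close> only if \<open>pverts G = UNIV\<close>, as is the case for \<^const>\<open>gen_paley\<close>.
\<close>

definition adjacency_matrix :: "'a::finite pair_pre_digraph \<Rightarrow> complex ^ 'a ^ 'a" where
  "adjacency_matrix G = (\<chi> x y. if (x, y) \<in> parcs G then 1 else 0)"

definition charpoly :: "'a::comm_ring_1 ^ 'n ^ 'n \<Rightarrow> 'a poly" where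
  "charpoly A = det (mat [:0, 1:] - (\<chi> i j. [:A $ i $ j:]))"

text \<open>Eigenvalues are counted with algebraic multiplicity.\<close>

definition Spec :: "'a::finite pair_pre_digraph \<Rightarrow> complex multiset" where
  "Spec G = proots (charpoly (adjacency_matrix G))"

end

theory Submission
  imports Defs "HOL-Number_Theory.Residues"
begin

text \<open>
  The connection set \<open>R\<^sub>k\<close> is a subgroup of the multiplicative group, so the graph is undirected
  iff \<open>-1 \<in> R\<^sub>k\<close>, which happens iff \<open>2k\<close> divides \<open>q - 1\<close>. If this fails although \<open>k = 2h\<close> divides
  \<open>q - 1\<close>, then \<open>n = (q - 1) / k\<close> is odd. Hence \<open>y ^ n = \<plusminus>1\<close> for every \<open>y \<in> R\<^sub>h\<close>, and as
  \<open>y\<close> and \<open>y ^ n\<close> differ by an even power of \<open>y\<close>, which lies in \<open>R\<^sub>k\<close>, we get \<open>R\<^sub>h = R\<^sub>k \<union> -R\<^sub>k\<close>.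

  For the spectra, fix a nontrivial additive character \<open>\<psi>\<close> of the field. The vectors
  \<open>x \<mapsto> \<psi> (a x)\<close> form an eigenbasis of every Cayley digraph of the additive group; the
  eigenvalue for the connection set \<open>R\<close> is \<open>\<Sum>r\<in>R. \<psi> (a r)\<close>. Since \<open>\<psi> (-x)\<close> is the conjugate of
  \<open>\<psi> x\<close>, passing from \<open>R\<^sub>k\<close> to \<open>R\<^sub>k \<union> -R\<^sub>k\<close> replaces each eigenvalue by twice its real part.
\<close>

unbundle no Formal_Power_Series.fps_syntax
hide_const (open) up_ring.monom up_ring.coeff


section \<open>Powers in finite fields\<close>

lemma one_less_card: "1 < CARD('a::{zero_neq_one,finite})"
proof -
  have "card {0, 1 :: 'a} \<le> CARD('a)"
    by (rule card_mono) auto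
  then show ?thesis
    by simp
qed

text \<open>
  The type class of \<open>finite_field_power_card_eq_same\<close> in the library is not implied by the sort
  \<open>{field,finite}\<close>.
\<close>

lemma finite_field_power_card_minus_1:
  fixes x :: "'a::{field,finite}"
  assumes "x \<noteq> 0"
  shows "x ^ (CARD('a) - 1) = 1"
proof -
  have "(\<Prod>y\<in>UNIV-{0}. x * y) = (\<Prod>y\<in>UNIV-{0}. y)"
    by (rule prod.reindex_bij_witness[of _ "\<lambda>y. y / x" "\<lambda>y. x * y"]) (use assms in auto)
  then have "x ^ (CARD('a) - 1) * \<Prod>(UNIV-{0::'a}) = \<Prod>(UNIV-{0::'a})"
    by (simp add: prod.distrib)
  moreover have "\<Prod>(UNIV-{0::'a}) \<noteq> 0"
    by simp
  ultimately show ?thesis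
    by simp
qed

lemma finite_field_power_card:
  fixes x :: "'a::{field,finite}"
  shows "x ^ CARD('a) = x"
proof (cases "x = 0")
  case False
  then show ?thesis
    using finite_field_power_card_minus_1 [of x] power_minus_mult [of "CARD('a)" x] by simp
qed simp

lemma card_poly_roots_dvd:
  fixes f g :: "'a::idom poly"
  assumes "f \<noteq> 0" "g dvd f" "card {x. poly f x = 0} = degree f"
  shows "card {x. poly g x = 0} = degree g"
proof -
  obtain h where h: "f = g * h"
    using assms(2) by (elim dvdE)
  then have nz: "g \<noteq> 0" "h \<noteq> 0"
    using assms(1) by auto
  have "degree f = card ({x. poly g x = 0} \<union> {x. poly h x = 0})"
    unfolding assms(3) [symmetric] by (simp add: h Collect_disj_eq)
  also have "\<dots> \<le> card {x. poly g x = 0} + card {x. poly h x = 0}"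
    by (rule card_Un_le)
  finally show ?thesis
    using card_poly_roots_bound [OF nz(1)] card_poly_roots_bound [OF nz(2)]
      degree_mult_eq [OF nz] by (simp add: h)
qed

lemma degree_monom_add_const:
  "0 < n \<Longrightarrow> degree (monom 1 n + [:c:] :: 'a::comm_ring_1 poly) = n"
  by (subst degree_add_eq_left) (auto simp: degree_monom_eq)

text \<open>
  \<open>X\<^sup>k + 1\<close> divides \<open>X\<^bsup>q-1\<^esup> - 1\<close>, whose roots are all the nonzero elements. This avoids the
  cyclicity of the multiplicative group.
\<close>

lemma card_power_eq_minus_one:
  assumes "0 < k" "2 * k dvd CARD('a::{field,finite}) - 1"
  shows "card {x::'a. x ^ k = - 1} = k"
proof -
  let ?q = "CARD('a)"
  define f g :: "'a poly" where "f = monom 1 (?q - 1) + [:-1:]" and "g = monom 1 k + [:1:]"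
  have degree_f: "degree f = ?q - 1"
    using one_less_card [where 'a = 'a] by (simp add: f_def degree_monom_add_const)
  then have "f \<noteq> 0"
    using one_less_card [where 'a = 'a] by auto
  moreover have "g dvd f"
  proof -
    obtain j where j: "?q - 1 = 2 * k * j"
      using assms(2) by (auto elim: dvdE)
    define X :: "'a poly" where "X = monom 1 k"
    have "f = (X\<^sup>2) ^ j - 1"
      unfolding f_def j
      by (simp add: X_def monom_power mult_ac one_pCons diff_conv_add_uminus
          del: add_uminus_conv_diff flip: power_mult)
    also have "\<dots> = (X\<^sup>2 - 1) * (\<Sum>i<j. (X\<^sup>2) ^ i)"
      by (rule power_diff_1_eq)
    also have "X\<^sup>2 - 1 = g * (X - 1)"
      by (simp add: g_def X_def algebra_simps power2_eq_square one_pCons [symmetric])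
    finally show ?thesis
      by (simp add: mult.assoc)
  qed
  moreover have "poly f x = 0 \<longleftrightarrow> x \<noteq> 0" for x
    using finite_field_power_card_minus_1 [of x] one_less_card [where 'a = 'a]
    by (cases "x = 0") (simp_all add: f_def poly_monom power_0_left)
  then have "card {x. poly f x = 0} = degree f"
    by (simp add: degree_f Collect_neg_eq Compl_eq_Diff_UNIV)
  ultimately have "card {x. poly g x = 0} = degree g"
    by (rule card_poly_roots_dvd)
  then show ?thesis
    using assms(1) by (simp add: g_def poly_monom degree_monom_add_const eq_neg_iff_add_eq_0)
qed

lemma one_neq_minus_one_of_odd_card:
  assumes "odd CARD('a::{ring_1,zero_neq_one,finite})"
  shows "(1 :: 'a) \<noteq> - 1"
proof
  assume "(1 :: 'a) = - 1"
  then have "(of_nat 2 :: 'a) = 0"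
    by (simp add: eq_neg_iff_add_eq_0)
  then have "CHAR('a) dvd 2"
    by (simp only: of_nat_eq_0_iff_char_dvd)
  moreover have "coprime 2 CARD('a)"
    using assms by simp
  ultimately have "CHAR('a) dvd 1"
    using CHAR_dvd_CARD [where 'a = 'a] by (metis coprime_common_divisor)
  then show False
    using CHAR_not_1 [where 'a = 'a] by simp
qed


section \<open>The groups of \<open>k\<close>-th powers\<close>

lemma power_set_1: "1 \<in> power_set k"
  unfolding power_set_def by (rule image_eqI [of _ _ 1]) auto

lemma power_set_mult:
  assumes "x \<in> power_set k" "y \<in> power_set k"
  shows "x * y \<in> power_set k"
proof -
  obtain a b where "a \<noteq> 0" "x = a ^ k" "b \<noteq> 0" "y = b ^ k"
    using assms unfolding power_set_def by blast
  then show ?thesis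
    unfolding power_set_def by (intro image_eqI [of _ _ "a * b"]) (simp_all add: power_mult_distrib)
qed

lemma power_set_inverse:
  assumes "x \<in> power_set k"
  shows "inverse x \<in> power_set k"
proof -
  obtain a where "a \<noteq> 0" "x = a ^ k"
    using assms unfolding power_set_def by blast
  then show ?thesis
    unfolding power_set_def by (intro image_eqI [of _ _ "inverse a"]) (simp_all add: power_inverse)
qed

lemma power_set_power:
  assumes "x \<in> power_set k"
  shows "x ^ n \<in> power_set (n * k)"
proof -
  obtain y where "y \<noteq> 0" "x = y ^ k"
    using assms unfolding power_set_def by blast
  then show ?thesis
    unfolding power_set_def by (intro image_eqI [of _ _ y])
      (simp_all add: mult.commute flip: power_mult)
qed

lemma power_set_mono:
  assumes "k dvd l"
  shows "power_set l \<subseteq> power_set k"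
proof
  fix y :: 'a
  assume "y \<in> power_set l"
  then obtain x where x: "x \<noteq> 0" "y = x ^ l"
    unfolding power_set_def by blast
  obtain j where "l = j * k"
    using assms by (metis dvd_div_mult_self)
  then have "y = (x ^ j) ^ k"
    by (simp add: x(2) power_mult)
  then show "y \<in> power_set k"
    unfolding power_set_def using x(1) by (intro image_eqI [of _ _ "x ^ j"]) simp_all
qed

lemma gp_undirected_iff_minus_one:
  "gp_undirected TYPE('a::field) k \<longleftrightarrow> (- 1 :: 'a) \<in> power_set k"
proof
  assume "gp_undirected TYPE('a) k"
  then show "(- 1 :: 'a) \<in> power_set k"
    using power_set_1 unfolding gp_undirected_def by blast
next
  assume "(- 1 :: 'a) \<in> power_set k"
  then have neg: "- x \<in> power_set k" if "x \<in> power_set k" for x :: 'a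
    using power_set_mult [OF _ that] by fastforce
  have "x \<in> uminus ` power_set k" if "x \<in> power_set k" for x :: 'a
    using neg [OF that] by (intro image_eqI [of _ _ "- x"]) auto
  with neg show "gp_undirected TYPE('a) k"
    unfolding gp_undirected_def by blast
qed

lemma power_set_Int_uminus:
  assumes "gp_directed TYPE('a::field) k"
  shows "(power_set k :: 'a set) \<inter> uminus ` power_set k = {}"
proof (rule ccontr)
  assume "\<not> ?thesis"
  then obtain y :: 'a where y: "y \<in> power_set k" "- y \<in> power_set k"
    by auto
  then have "- y * inverse y \<in> power_set k"
    by (intro power_set_mult power_set_inverse)
  moreover have "y \<noteq> 0"
    using y unfolding power_set_def by auto
  ultimately show False
    using assms by (simp add: gp_undirected_iff_minus_one)
qed

lemma gp_undirected_if_double_dvd: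
  assumes "0 < k" "2 * k dvd CARD('a::{field,finite}) - 1"
  shows "gp_undirected TYPE('a) k"
proof -
  have "{x::'a. x ^ k = - 1} \<noteq> {}"
    using card_power_eq_minus_one [OF assms] assms(1) by (metis card.empty less_irrefl)
  then obtain x :: 'a where "x ^ k = - 1"
    by blast
  moreover from this have "x \<noteq> 0"
    using assms(1) by (auto simp: power_0_left)
  ultimately show ?thesis
    unfolding gp_undirected_iff_minus_one power_set_def by force
qed

lemma gp_undirected_iff_double_dvd:
  assumes "odd CARD('a::{field,finite})" "0 < k" "k dvd CARD('a) - 1"
  shows "gp_undirected TYPE('a) k \<longleftrightarrow> 2 * k dvd CARD('a) - 1"
proof
  assume "gp_undirected TYPE('a) k"
  then obtain x :: 'a where x: "x \<noteq> 0" "x ^ k = - 1"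
    unfolding gp_undirected_iff_minus_one power_set_def by force
  obtain n where n: "CARD('a) - 1 = k * n"
    using assms(3) by (elim dvdE)
  have "(- 1 :: 'a) ^ n = 1"
    using finite_field_power_card_minus_1 [OF x(1)] unfolding n power_mult x(2) .
  then have "even n"
    using one_neq_minus_one_of_odd_card [OF assms(1)]
    by (simp add: minus_one_power_iff split: if_splits)
  then show "2 * k dvd CARD('a) - 1"
    unfolding n by auto
qed (use assms(2) gp_undirected_if_double_dvd in blast)

lemma prime_elem_mult_dvd_iff_multiplicity_less:
  fixes p a b :: "'a::factorial_semiring"
  assumes "prime_elem p" "a dvd b" "b \<noteq> 0"
  shows "p * a dvd b \<longleftrightarrow> multiplicity p a < multiplicity p b"
proof -
  obtain c where c: "b = a * c"
    using assms(2) by (elim dvdE)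
  then have "p * a dvd b \<longleftrightarrow> p dvd c"
    using assms(3) by (simp add: mult.commute [of p])
  also have "\<dots> \<longleftrightarrow> 0 < multiplicity p c"
    using assms c by (auto simp: multiplicity_gt_zero_iff)
  also have "\<dots> \<longleftrightarrow> multiplicity p a < multiplicity p b"
    using assms c by (simp add: prime_elem_multiplicity_mult_distrib)
  finally show ?thesis .
qed

lemma gp_undirected_iff_multiplicity_less:
  assumes "odd CARD('a::{field,finite})" "0 < k" "k dvd CARD('a) - 1"
  shows "gp_undirected TYPE('a) k \<longleftrightarrow> multiplicity 2 k < multiplicity 2 (CARD('a) - 1)"
proof -
  have "CARD('a) - 1 \<noteq> 0"
    using one_less_card [where 'a = 'a] by simp
  then have "2 * k dvd CARD('a) - 1 \<longleftrightarrow> multiplicity 2 k < multiplicity 2 (CARD('a) - 1)"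
    using assms(3)
    by (intro prime_elem_mult_dvd_iff_multiplicity_less prime_imp_prime_elem two_is_prime_nat)
  with gp_undirected_iff_double_dvd [OF assms] show ?thesis
    by (rule trans)
qed

lemma gp_directed_imp_even:
  assumes "odd CARD('a::{field,finite})" "0 < k" "k dvd CARD('a) - 1" "gp_directed TYPE('a) k"
  shows "even k"
proof -
  obtain n where n: "CARD('a) - 1 = k * n"
    using assms(3) by (elim dvdE)
  have "\<not> 2 * k dvd k * n"
    using gp_undirected_if_double_dvd [OF assms(2), where 'a = 'a] assms(4) unfolding n by blast
  then have "odd n"
    by auto
  moreover have "even (k * n)"
    using assms(1) unfolding n [symmetric] by simp
  ultimately show ?thesis
    by simp
qed

lemma power_set_subset_Un_uminus:
  assumes "2 * h dvd CARD('a::{field,finite}) - 1" "odd ((CARD('a) - 1) div (2 * h))"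
  shows "(power_set h :: 'a set) \<subseteq> power_set (2 * h) \<union> uminus ` power_set (2 * h)"
proof
  fix y :: 'a
  assume y: "y \<in> power_set h"
  define n where "n = (CARD('a) - 1) div (2 * h)"
  have n: "CARD('a) - 1 = 2 * h * n"
    using assms(1) by (simp add: n_def)
  obtain j where j: "n = 2 * j + 1"
    using assms(2) unfolding n_def by (elim oddE)
  obtain x where x: "x \<noteq> 0" "y = x ^ h"
    using y unfolding power_set_def by blast
  then have "(y ^ n)\<^sup>2 = 1"
    using finite_field_power_card_minus_1 [OF x(1)] unfolding n
    by (simp add: mult_ac flip: power_mult)
  then have sign: "y ^ n = 1 \<or> y ^ n = - 1"
    by (simp add: power2_eq_1_iff)
  define z where "z = inverse ((y ^ j)\<^sup>2)"
  have "y ^ j \<in> power_set h"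
    using power_set_power [OF y] power_set_mono [of h "j * h"] by auto
  then have z: "z \<in> power_set (2 * h)"
    unfolding z_def by (intro power_set_inverse power_set_power)
  have "y = y ^ n * z"
    using x by (simp add: j z_def field_simps power_add flip: power_mult)
  with sign z show "y \<in> power_set (2 * h) \<union> uminus ` power_set (2 * h)"
    by (metis UnI1 UnI2 imageI mult_1 mult_minus1)
qed

lemma power_set_half:
  assumes "0 < h" "2 * h dvd CARD('a::{field,finite}) - 1" "gp_directed TYPE('a) (2 * h)"
  shows "(power_set h :: 'a set) = power_set (2 * h) \<union> uminus ` power_set (2 * h)"
proof (rule antisym)
  have "\<not> 2 * (2 * h) dvd CARD('a) - 1"
    using gp_undirected_if_double_dvd [of "2 * h", where 'a = 'a] assms(1,3) by auto
  then have "odd ((CARD('a) - 1) div (2 * h))"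
    using assms(1) by (subst dvd_div_iff_mult [OF _ assms(2)]) simp_all
  with assms(2) show "(power_set h :: 'a set) \<subseteq> power_set (2 * h) \<union> uminus ` power_set (2 * h)"
    by (rule power_set_subset_Un_uminus)
  have "gp_undirected TYPE('a) h"
    using assms(1,2) by (rule gp_undirected_if_double_dvd)
  then show "power_set (2 * h) \<union> uminus ` power_set (2 * h) \<subseteq> (power_set h :: 'a set)"
    using power_set_mono [of h "2 * h", where 'a = 'a] unfolding gp_undirected_def by auto
qed


section \<open>The trace and additive characters of a finite field\<close>

lemma CHAR_eq_prime_of_card:
  assumes "prime p" "CARD('a::{idom,finite}) = p ^ m"
  shows "CHAR('a) = p"
proof -
  have "prime CHAR('a)"
    using finite_imp_CHAR_pos [where 'a = 'a] by (intro prime_CHAR_semidom) auto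
  moreover have "CHAR('a) dvd p ^ m"
    using CHAR_dvd_CARD [where 'a = 'a] assms(2) by simp
  ultimately show ?thesis
    using assms(1) by (metis prime_dvd_power primes_dvd_imp_eq)
qed

lemma power_CHAR_eq_same_iff:
  fixes y :: "'a::idom"
  assumes "prime CHAR('a)"
  shows "y ^ CHAR('a) = y \<longleftrightarrow> y \<in> range of_nat"
proof
  let ?p = "CHAR('a)" and ?roots = "{y::'a. y ^ CHAR('a) = y}"
  define f where "f = monom (1::'a) ?p + [:0, -1:]"
  have gt1: "1 < ?p"
    using assms by (rule prime_gt_1_nat)
  have power_of_nat: "of_nat n ^ ?p = (of_nat n :: 'a)" for n
    using freshmans_dream_sum [OF assms refl, of "\<lambda>_. 1 :: 'a" "{..<n}"] by simp
  then show "y ^ ?p = y" if "y \<in> range of_nat"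
    using that by auto
  have degree_f: "degree f = ?p"
    unfolding f_def using gt1 by (subst degree_add_eq_left) (auto simp: degree_monom_eq)
  then have "f \<noteq> 0"
    using gt1 by auto
  have roots: "?roots = {y. poly f y = 0}"
    by (simp add: f_def poly_monom)
  have "inj_on (of_nat :: nat \<Rightarrow> 'a) {..<?p}"
    by (auto intro!: inj_onI simp: of_nat_eq_iff_cong_CHAR cong_def)
  then have "card ?roots \<le> card (of_nat ` {..<?p} :: 'a set)"
    using card_poly_roots_bound [OF \<open>f \<noteq> 0\<close>] by (simp add: roots degree_f card_image)
  moreover have "of_nat ` {..<?p} \<subseteq> ?roots"
    using power_of_nat by auto
  moreover have "finite ?roots"
    unfolding roots using \<open>f \<noteq> 0\<close> by (rule poly_roots_finite)
  ultimately have "?roots = of_nat ` {..<?p}"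
    by (intro card_seteq [symmetric])
  then show "y \<in> range of_nat" if "y ^ ?p = y"
    using that by auto
qed

text \<open>The trace to the prime field only if \<open>m\<close> is the degree of \<^typ>\<open>'a\<close> over it.\<close>

definition absolute_trace :: "nat \<Rightarrow> 'a::comm_semiring_1 \<Rightarrow> 'a" where
  "absolute_trace m x = (\<Sum>i<m. x ^ (CHAR('a) ^ i))"

lemma absolute_trace_add:
  fixes x y :: "'a::comm_semiring_1"
  assumes "prime CHAR('a)"
  shows "absolute_trace m (x + y) = absolute_trace m x + absolute_trace m y"
  by (simp add: absolute_trace_def freshmans_dream' [OF assms refl] sum.distrib)

lemma absolute_trace_power_CHAR:
  fixes x :: "'a::comm_ring_1"
  assumes "prime CHAR('a)" "x ^ (CHAR('a) ^ m) = x"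
  shows "absolute_trace m x ^ CHAR('a) = absolute_trace m x"
proof -
  let ?p = "CHAR('a)"
  have "absolute_trace m x ^ ?p = (\<Sum>i<m. x ^ (?p ^ Suc i))"
    unfolding absolute_trace_def
    by (simp add: freshmans_dream_sum [OF assms(1) refl] mult.commute flip: power_mult)
  then have "absolute_trace m x ^ ?p - absolute_trace m x =
      (\<Sum>i<m. x ^ (?p ^ Suc i) - x ^ (?p ^ i))"
    by (simp add: absolute_trace_def sum_subtractf)
  also have "\<dots> = x ^ (?p ^ m) - x ^ (?p ^ 0)"
    by (rule sum_lessThan_telescope)
  finally show ?thesis
    using assms(2) by simp
qed

lemma absolute_trace_in_range_of_nat:
  fixes x :: "'a::{field,finite}"
  assumes "prime CHAR('a)" "CARD('a) = CHAR('a) ^ m"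
  shows "absolute_trace m x \<in> range of_nat"
  using absolute_trace_power_CHAR [OF assms(1)] finite_field_power_card [of x]
  by (simp add: power_CHAR_eq_same_iff [OF assms(1), symmetric] assms(2))

lemma ex_absolute_trace_neq_0:
  assumes "prime CHAR('a::{field,finite})" "CARD('a) = CHAR('a) ^ m"
  shows "\<exists>x::'a. absolute_trace m x \<noteq> 0"
proof (rule ccontr)
  let ?p = "CHAR('a)"
  assume no_witness: "\<not> ?thesis"
  have gt1: "1 < ?p"
    using assms(1) by (rule prime_gt_1_nat)
  have "0 < m"
    using assms(2) one_less_card [where 'a = 'a] by (cases m) auto
  define f where "f = (\<Sum>i<m. monom (1::'a) (?p ^ i))"
  have "poly f x = absolute_trace m x" for x
    by (simp add: f_def absolute_trace_def poly_sum poly_monom)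
  then have roots: "{x. poly f x = 0} = UNIV"
    using no_witness by auto
  have "coeff f 1 = (\<Sum>i<m. if i = 0 then 1 else 0)"
    unfolding f_def coeff_sum using gt1 by (intro sum.cong) auto
  then have "f \<noteq> 0"
    using \<open>0 < m\<close> by auto
  have "degree f \<le> ?p ^ (m - 1)"
    unfolding f_def using gt1
    by (intro degree_sum_le) (auto simp: degree_monom_eq intro!: power_increasing)
  also have "\<dots> < ?p ^ m"
    using gt1 \<open>0 < m\<close> by (intro power_strict_increasing) auto
  finally show False
    using card_poly_roots_bound [OF \<open>f \<noteq> 0\<close>] by (simp add: roots assms(2))
qed

text \<open>Meaningful only on the prime subring, the range of \<^const>\<open>of_nat\<close>.\<close>

definition prime_field_character :: "'a::ring_1 \<Rightarrow> complex" where
  "prime_field_character y =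
    exp (2 * of_real pi * \<i> * of_nat (inv_into UNIV of_nat y) / of_nat CHAR('a))"

lemma prime_field_character_of_nat:
  assumes "0 < CHAR('a::ring_1)"
  shows "prime_field_character (of_nat n :: 'a) =
    exp (2 * of_real pi * \<i> * of_nat n / of_nat CHAR('a))"
proof -
  have "(of_nat (inv_into UNIV of_nat (of_nat n :: 'a)) :: 'a) = of_nat n"
    by (rule f_inv_into_f) simp
  then have "inv_into UNIV of_nat (of_nat n :: 'a) mod CHAR('a) = n mod CHAR('a)"
    by (simp add: of_nat_eq_iff_cong_CHAR cong_def)
  then show ?thesis
    unfolding prime_field_character_def using assms by (subst complex_root_unity_eq) auto
qed

definition additive_character :: "('a::group_add \<Rightarrow> complex) \<Rightarrow> bool" where
  "additive_character \<psi> \<longleftrightarrow> (\<forall>x y. \<psi> (x + y) = \<psi> x * \<psi> y) \<and> (\<forall>x. norm (\<psi> x) = 1)"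

definition nontrivial_additive_character :: "('a::group_add \<Rightarrow> complex) \<Rightarrow> bool" where
  "nontrivial_additive_character \<psi> \<longleftrightarrow> additive_character \<psi> \<and> (\<exists>x. \<psi> x \<noteq> 1)"

lemma nontrivial_additive_character_imp_additive_character:
  "nontrivial_additive_character \<psi> \<Longrightarrow> additive_character \<psi>"
  by (simp add: nontrivial_additive_character_def)

lemma additive_character_add: "additive_character \<psi> \<Longrightarrow> \<psi> (x + y) = \<psi> x * \<psi> y"
  by (simp add: additive_character_def)

lemma additive_character_norm: "additive_character \<psi> \<Longrightarrow> norm (\<psi> x) = 1"
  by (simp add: additive_character_def)

lemma additive_character_0: "additive_character \<psi> \<Longrightarrow> \<psi> 0 = 1"
  using additive_character_add [of \<psi> 0 0] additive_character_norm [of \<psi> 0] by auto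

lemma additive_character_minus:
  assumes "additive_character \<psi>"
  shows "\<psi> (- x) = cnj (\<psi> x)"
proof -
  have "\<psi> x * cnj (\<psi> x) = 1"
    by (simp add: additive_character_norm [OF assms] flip: complex_norm_square)
  moreover have "\<psi> x * \<psi> (- x) = 1"
    by (simp add: additive_character_0 [OF assms] flip: additive_character_add [OF assms])
  ultimately show ?thesis
    by (metis mult_cancel_left mult_zero_left zero_neq_one)
qed

lemma sum_nontrivial_additive_character:
  assumes "nontrivial_additive_character \<psi>"
  shows "(\<Sum>x\<in>UNIV. \<psi> x) = 0"
proof -
  obtain b where b: "\<psi> b \<noteq> 1" and character: "additive_character \<psi>"
    using assms unfolding nontrivial_additive_character_def by blast
  have "(\<Sum>x\<in>UNIV. \<psi> x) = (\<Sum>x\<in>UNIV. \<psi> (b + x))"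
    by (rule sum.reindex_bij_witness [of _ "\<lambda>x. b + x" "\<lambda>x. - b + x"])
      (simp_all flip: add.assoc)
  also have "\<dots> = \<psi> b * (\<Sum>x\<in>UNIV. \<psi> x)"
    by (simp add: additive_character_add [OF character] sum_distrib_left)
  finally show ?thesis
    using b by simp
qed

lemma sum_nontrivial_additive_character_mult:
  fixes \<psi> :: "'a::{field,finite} \<Rightarrow> complex"
  assumes "nontrivial_additive_character \<psi>"
  shows "(\<Sum>x\<in>UNIV. \<psi> (a * x)) = (if a = 0 then of_nat CARD('a) else 0)"
proof (cases "a = 0")
  case True
  then show ?thesis
    using additive_character_0 [OF nontrivial_additive_character_imp_additive_character [OF assms]]
    by simp
next
  case False
  have "(\<Sum>x\<in>UNIV. \<psi> (a * x)) = (\<Sum>x\<in>UNIV. \<psi> x)"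
    by (rule sum.reindex_bij_witness [of _ "\<lambda>x. x / a" "\<lambda>x. a * x"]) (use False in auto)
  then show ?thesis
    using False by (simp add: sum_nontrivial_additive_character [OF assms])
qed

lemma additive_character_absolute_trace:
  assumes "prime CHAR('a::{field,finite})" "CARD('a) = CHAR('a) ^ m"
  shows "additive_character (\<lambda>x::'a. prime_field_character (absolute_trace m x))"
  unfolding additive_character_def
proof (intro conjI allI)
  fix x y :: 'a
  obtain a b where ab: "absolute_trace m x = of_nat a" "absolute_trace m y = of_nat b"
    using absolute_trace_in_range_of_nat [OF assms] by (metis rangeE)
  then have "absolute_trace m (x + y) = of_nat (a + b)"
    by (simp add: absolute_trace_add [OF assms(1)])
  then show "prime_field_character (absolute_trace m (x + y)) =
      prime_field_character (absolute_trace m x) * prime_field_character (absolute_trace m y)"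
    unfolding ab by (simp only: prime_field_character_of_nat [OF prime_gt_0_nat [OF assms(1)]])
      (simp add: add_divide_distrib ring_distribs exp_add)
qed (simp add: prime_field_character_def norm_exp_eq_Re)

lemma nontrivial_additive_character_absolute_trace:
  assumes "prime CHAR('a::{field,finite})" "CARD('a) = CHAR('a) ^ m"
  shows "nontrivial_additive_character (\<lambda>x::'a. prime_field_character (absolute_trace m x))"
proof -
  obtain x :: 'a where "absolute_trace m x \<noteq> 0"
    using ex_absolute_trace_neq_0 [OF assms] by blast
  moreover obtain n where n: "absolute_trace m x = of_nat n"
    using absolute_trace_in_range_of_nat [OF assms] by (metis rangeE)
  ultimately have "\<not> CHAR('a) dvd n"
    by (simp add: of_nat_eq_0_iff_char_dvd)
  then have "prime_field_character (absolute_trace m x) \<noteq> 1"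
    using prime_gt_0_nat [OF assms(1)]
    by (simp add: n prime_field_character_of_nat complex_root_unity_eq_1 Suc_le_eq)
  then show ?thesis
    using additive_character_absolute_trace [OF assms]
    unfolding nontrivial_additive_character_def by blast
qed


section \<open>Characteristic polynomials of diagonalizable matrices\<close>

definition const_poly_matrix :: "'a::zero ^ 'n ^ 'm \<Rightarrow> 'a poly ^ 'n ^ 'm" where
  "const_poly_matrix A = (\<chi> i j. [:A $ i $ j:])"

lemma const_poly_matrix_mult:
  fixes A :: "'a::comm_semiring_1 ^ 'n ^ 'm" and B :: "'a ^ 'k ^ 'n"
  shows "const_poly_matrix A ** const_poly_matrix B = const_poly_matrix (A ** B)"
  by (simp add: const_poly_matrix_def matrix_matrix_mult_def vec_eq_iff mult.commute
      flip: sum_to_poly)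

lemma det_const_poly_matrix:
  fixes A :: "'a::comm_ring_1 ^ 'n ^ 'n"
  shows "det (const_poly_matrix A) = [:det A:]"
  by (simp add: const_poly_matrix_def det_def of_int_poly prod_to_poly mult.commute
      flip: sum_to_poly)

lemma mat_mult_commute:
  fixes A :: "'a::comm_semiring_1 ^ 'n ^ 'n"
  shows "mat c ** A = A ** mat c"
  by (simp add: matrix_matrix_mult_def mat_def vec_eq_iff if_distrib if_distribR mult.commute
      sum.delta sum.delta' cong: if_cong)

lemma matrix_diff_ldistrib:
  fixes A :: "'a::ring_1 ^ 'n ^ 'm"
  shows "A ** (B - C) = A ** B - A ** C"
  by (simp add: matrix_matrix_mult_def vec_eq_iff right_diff_distrib sum_subtractf)

lemma matrix_diff_rdistrib:
  fixes A B :: "'a::ring_1 ^ 'n ^ 'm"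
  shows "(A - B) ** C = A ** C - B ** C"
  by (simp add: matrix_matrix_mult_def vec_eq_iff left_diff_distrib sum_subtractf)

lemma charpoly_eq_if_intertwined:
  fixes A B V :: "'a::idom ^ 'n ^ 'n"
  assumes "A ** V = V ** B" "det V \<noteq> 0"
  shows "charpoly A = charpoly B"
proof -
  let ?C = "const_poly_matrix :: 'a ^ 'n ^ 'n \<Rightarrow> 'a poly ^ 'n ^ 'n"
  let ?X = "mat [:0, 1:] :: 'a poly ^ 'n ^ 'n"
  have "(?X - ?C A) ** ?C V = ?X ** ?C V - ?C (A ** V)"
    by (simp only: matrix_diff_rdistrib const_poly_matrix_mult)
  also have "\<dots> = ?C V ** ?X - ?C (V ** B)"
    by (simp only: mat_mult_commute assms(1))
  also have "\<dots> = ?C V ** (?X - ?C B)"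
    by (simp only: matrix_diff_ldistrib const_poly_matrix_mult)
  finally have "det (?X - ?C A) * det (?C V) = det (?C V) * det (?X - ?C B)"
    by (simp only: flip: det_mul)
  moreover have "det (?C V) \<noteq> 0"
    using assms(2) by (simp add: det_const_poly_matrix)
  ultimately show ?thesis
    by (simp add: charpoly_def flip: const_poly_matrix_def)
qed

lemma charpoly_diagonal:
  fixes d :: "'n::finite \<Rightarrow> 'a::comm_ring_1"
  shows "charpoly (\<chi> i j. if i = j then d i else 0) = (\<Prod>i\<in>UNIV. [:- d i, 1:])"
  unfolding charpoly_def by (subst det_diagonal) (auto simp: mat_def)


section \<open>Spectra of Cayley digraphs\<close>

definition cayley_digraph :: "'a::group_add set \<Rightarrow> 'a pair_pre_digraph" where
  "cayley_digraph R = \<lparr>pverts = UNIV, parcs = {(x, y). y - x \<in> R}\<rparr>"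

lemma gen_paley_eq_cayley_digraph: "gen_paley k = cayley_digraph (power_set k)"
  by (simp add: gen_paley_def cayley_digraph_def)

lemma parcs_cayley_digraph_Un_uminus:
  "parcs (cayley_digraph (R \<union> uminus ` R)) =
    parcs (cayley_digraph R) \<union> (parcs (cayley_digraph R))\<inverse>"
proof -
  have "d \<in> uminus ` R \<longleftrightarrow> - d \<in> R" for d :: 'a
    by (metis image_iff minus_minus)
  then show ?thesis
    by (auto simp: cayley_digraph_def)
qed

lemma adjacency_matrix_cayley_digraph:
  fixes R :: "'a::{group_add,finite} set"
  shows "adjacency_matrix (cayley_digraph R) = (\<chi> x y. if y - x \<in> R then 1 else 0)"
  by (simp add: adjacency_matrix_def cayley_digraph_def)

definition character_matrix :: "('a::{times,finite} \<Rightarrow> complex) \<Rightarrow> ((complex, 'a) vec, 'a) vec" where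
  "character_matrix \<psi> = (\<chi> x a. \<psi> (a * x))"

lemma det_character_matrix:
  fixes \<psi> :: "'a::{field,finite} \<Rightarrow> complex"
  assumes "nontrivial_additive_character \<psi>"
  shows "det (character_matrix \<psi>) \<noteq> 0"
proof -
  note character = nontrivial_additive_character_imp_additive_character [OF assms]
  define W where "W = (\<chi> a x. \<psi> (- (a * x)))"
  have "(character_matrix \<psi> ** W) $ x $ y = (\<Sum>a\<in>UNIV. \<psi> ((x - y) * a))" for x y
    by (simp add: matrix_matrix_mult_def character_matrix_def W_def algebra_simps
        flip: additive_character_add [OF character])
  then have "character_matrix \<psi> ** W = mat (of_nat CARD('a))"
    by (simp add: vec_eq_iff sum_nontrivial_additive_character_mult [OF assms] mat_def)
  then have "det (character_matrix \<psi> ** W) \<noteq> 0"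
    by (simp add: det_diagonal mat_def)
  then show ?thesis
    by (auto simp: det_mul)
qed

lemma adjacency_matrix_mult_character_matrix:
  fixes \<psi> :: "'a::{ring,finite} \<Rightarrow> complex"
  assumes "additive_character \<psi>"
  shows "adjacency_matrix (cayley_digraph R) ** character_matrix \<psi> =
    character_matrix \<psi> ** (\<chi> a b. if a = b then \<Sum>r\<in>R. \<psi> (a * r) else 0)"
    (is "?A ** ?V = ?V ** ?D")
proof -
  have "(?A ** ?V) $ x $ a = (?V ** ?D) $ x $ a" for x a
  proof -
    have "(?A ** ?V) $ x $ a = (\<Sum>y\<in>{y. y - x \<in> R}. \<psi> (a * y))"
      by (simp add: matrix_matrix_mult_def adjacency_matrix_cayley_digraph character_matrix_def
          if_distrib [where f = "\<lambda>t. t * z" for z] sum.If_cases cong: if_cong)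
    also have "\<dots> = (\<Sum>r\<in>R. \<psi> (a * x + a * r))"
      by (rule sum.reindex_bij_witness [of _ "\<lambda>r. x + r" "\<lambda>y. y - x"]) (auto simp: algebra_simps)
    also have "\<dots> = \<psi> (a * x) * (\<Sum>r\<in>R. \<psi> (a * r))"
      by (simp add: additive_character_add [OF assms] sum_distrib_left)
    also have "\<dots> = (?V ** ?D) $ x $ a"
      by (simp add: matrix_matrix_mult_def character_matrix_def if_distrib cong: if_cong)
    finally show ?thesis .
  qed
  then show ?thesis
    by (simp add: vec_eq_iff)
qed

lemma Spec_cayley_digraph:
  fixes \<psi> :: "'a::{field,finite} \<Rightarrow> complex"
  assumes "nontrivial_additive_character \<psi>"
  shows "Spec (cayley_digraph R) = image_mset (\<lambda>a. \<Sum>r\<in>R. \<psi> (a * r)) (mset_set UNIV)"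
proof -
  note character = nontrivial_additive_character_imp_additive_character [OF assms]
  have "charpoly (adjacency_matrix (cayley_digraph R)) =
      charpoly (\<chi> a b. if a = b then \<Sum>r\<in>R. \<psi> (a * r) else 0)"
    using adjacency_matrix_mult_character_matrix [OF character]
      det_character_matrix [OF assms]
    by (rule charpoly_eq_if_intertwined)
  then have "Spec (cayley_digraph R) = (\<Sum>a\<in>UNIV. {#\<Sum>r\<in>R. \<psi> (a * r)#})"
    by (simp add: Spec_def charpoly_diagonal proots_prod)
  then show ?thesis
    by (simp add: sum_unfold_sum_mset)
qed

lemma sum_additive_character_Un_uminus:
  fixes \<psi> :: "'a::{ring,finite} \<Rightarrow> complex"
  assumes "additive_character \<psi>" "R \<inter> uminus ` R = {}"
  shows "(\<Sum>r\<in>R \<union> uminus ` R. \<psi> (a * r)) = complex_of_real (2 * Re (\<Sum>r\<in>R. \<psi> (a * r)))"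
proof -
  have "(\<Sum>r\<in>R \<union> uminus ` R. \<psi> (a * r)) = (\<Sum>r\<in>R. \<psi> (a * r)) + (\<Sum>r\<in>uminus ` R. \<psi> (a * r))"
    using assms(2) by (intro sum.union_disjoint) auto
  also have "(\<Sum>r\<in>uminus ` R. \<psi> (a * r)) = cnj (\<Sum>r\<in>R. \<psi> (a * r))"
    by (simp add: sum.reindex additive_character_minus [OF assms(1)])
  finally show ?thesis
    by (simp only: complex_add_cnj)
qed

lemma Spec_cayley_digraph_Un_uminus:
  fixes \<psi> :: "'a::{field,finite} \<Rightarrow> complex" and R :: "'a set"
  assumes "nontrivial_additive_character \<psi>" "R \<inter> uminus ` R = {}"
  shows "Spec (cayley_digraph (R \<union> uminus ` R)) =
    image_mset (\<lambda>l. complex_of_real (2 * Re l)) (Spec (cayley_digraph R))"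
  using nontrivial_additive_character_imp_additive_character [OF assms(1)] assms(2)
  by (simp add: Spec_cayley_digraph [OF assms(1)] multiset.map_comp comp_def
      sum_additive_character_Un_uminus)

lemma parcs_gen_paley_half:
  assumes "0 < h" "2 * h dvd CARD('a::{field,finite}) - 1" "gp_directed TYPE('a) (2 * h)"
  shows "parcs (gen_paley h :: 'a pair_pre_digraph) =
    parcs (gen_paley (2 * h)) \<union> (parcs (gen_paley (2 * h)))\<inverse>"
  by (simp add: gen_paley_eq_cayley_digraph power_set_half [OF assms]
      parcs_cayley_digraph_Un_uminus)

lemma Spec_gen_paley_half:
  assumes "prime p" "CARD('a::{field,finite}) = p ^ m"
    and "0 < h" "2 * h dvd CARD('a) - 1" "gp_directed TYPE('a) (2 * h)"
  shows "Spec (gen_paley h :: 'a pair_pre_digraph) =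
    image_mset (\<lambda>l. complex_of_real (2 * Re l)) (Spec (gen_paley (2 * h) :: 'a pair_pre_digraph))"
proof -
  have "CHAR('a) = p"
    using assms(1,2) by (rule CHAR_eq_prime_of_card)
  then have "nontrivial_additive_character (\<lambda>x::'a. prime_field_character (absolute_trace m x))"
    using assms(1,2) by (intro nontrivial_additive_character_absolute_trace) simp_all
  then show ?thesis
    using power_set_Int_uminus [OF assms(5)]
    by (simp add: gen_paley_eq_cayley_digraph power_set_half [OF assms(3-5)]
        Spec_cayley_digraph_Un_uminus)
qed

theorem theorem3p5:
  fixes p m q k :: nat
  assumes "prime p" and "odd p" and "0 < m" and "q = p ^ m"
    and "CARD('a::{field,finite}) = q"
    and "0 < k" and "k dvd q - 1"
  shows "(gp_undirected TYPE('a) k \<longleftrightarrow>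
            multiplicity 2 k < multiplicity 2 (q - 1) \<or> multiplicity 2 k = 0) \<and>
         (gp_directed TYPE('a) k \<longleftrightarrow>
            multiplicity 2 k = multiplicity 2 (q - 1) \<and> multiplicity 2 (q - 1) > 0) \<and>
         (gp_directed TYPE('a) k \<longrightarrow>
            even k \<and>
            gp_undirected TYPE('a) (k div 2) \<and>
            parcs (gen_paley (k div 2) :: 'a pair_pre_digraph) =
              parcs (gen_paley k) \<union> (parcs (gen_paley k))\<inverse> \<and>
            (power_set (k div 2) :: 'a set) = power_set k \<union> uminus ` power_set k \<and>
            (power_set k :: 'a set) \<inter> uminus ` power_set k = {} \<and>
            Spec (gen_paley (k div 2) :: 'a pair_pre_digraph) =
              image_mset (\<lambda>l. complex_of_real (2 * Re l)) (Spec (gen_paley k :: 'a pair_pre_digraph)))"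
    (is "?undirected \<and> ?directed \<and> (_ \<longrightarrow> ?half)")
proof -
  have odd: "odd CARD('a)" and k: "k dvd CARD('a) - 1"
    using assms by simp_all
  have "even (q - 1)" "q - 1 \<noteq> 0"
    using odd one_less_card [where 'a = 'a] \<open>CARD('a) = q\<close> by simp_all
  then have "0 < multiplicity 2 (q - 1)" "multiplicity 2 k \<le> multiplicity 2 (q - 1)"
    using \<open>k dvd q - 1\<close> by (simp_all add: multiplicity_gt_zero_iff dvd_imp_multiplicity_le)
  then have ?undirected ?directed
    using gp_undirected_iff_multiplicity_less [OF odd \<open>0 < k\<close> k] \<open>CARD('a) = q\<close> by auto
  moreover have ?half if directed: "gp_directed TYPE('a) k"
  proof -
    have "even k"
      using odd \<open>0 < k\<close> k directed by (rule gp_directed_imp_even)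
    then obtain h where h: "k = 2 * h" "0 < h"
      using \<open>0 < k\<close> by (auto elim: evenE)
    note half = h(2) k [unfolded h(1)] directed [unfolded h(1)]
    show ?thesis
      using gp_undirected_if_double_dvd [OF half(1,2)] parcs_gen_paley_half [OF half]
        power_set_half [OF half] power_set_Int_uminus [OF half(3)]
        Spec_gen_paley_half [OF \<open>prime p\<close> _ half] \<open>CARD('a) = q\<close> \<open>q = p ^ m\<close>
      by (simp add: h(1))
  qed
  ultimately show ?thesis
    by blast
qed

end
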